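(* Let $\{x_{mn}\}$ be a double sequence in an intuitionistic fuzzy normed space $(X,\mu,\nu,\star,\circ)$, let $r>0$, let $\lambda\in(0,1)$ and let $c>2$ be a real number. Then there do not exist $\beta_1,\beta_2\in\mathcal{I}_2^{(\mu,\nu)}\text{-}LIM_{x_{mn}}^r$ such that $\mu(\beta_1-\beta_2,cr)\le1-\lambda$ and $\nu(\beta_1-\beta_2,cr)\ge\lambda$.
   Context: $\mathcal{I}_2$ is a fixed non-trivial admissible ideal of subsets of $\mathbb{N}\times\mathbb{N}$ (that is, $\mathbb{N}\times\mathbb{N}\notin\mathcal{I}_2$ and every singleton belongs to $\mathcal{I}_2$). A continuous $t$-norm (resp. $t$-conorm) is an associative, commutative, continuous binary operation $\star$ (resp. $\circ$) on $[0,1]$, monotone in each argument, with $x\star 1=x$ (resp. $x\circ 0=x$) for all $x\in[0,1]$. An intuitionistic fuzzy normed space (IFNS) is a 5-tuple $(X,\mu,\nu,\star,\circ)$ where $X$ is a normed linear space, $\star$ is a continuous $t$-norm, $\circ$ is a continuous $t$-conorm, and $\mu,\nu:X\times(0,\infty)\to[0,1]$ satisfy for all $x,y\in X$, $s,t>0$: $\mu(x,t)+\nu(x,t)\le 1$; $\mu(x,t)>0$; $\mu(x,t)=1$ iff $x=0$; $\mu(\alpha x,t)=\mu(x,t/|\alpha|)$ for each scalar $\alpha\ne0$; $\mu(x,t)\star\mu(y,s)\le\mu(x+y,t+s)$; $\mu(x,\cdot)$ is continuous on $(0,\infty)$; $\lim_{t\to\infty}\mu(x,t)=1$, and $\lim_{t\to0}\mu(x,t)=0$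 for $x\neq 0$; $\nu(x,t)<1$; $\nu(x,t)=0$ iff $x=0$; $\nu(\alpha x,t)=\nu(x,t/|\alpha|)$ for each scalar $\alpha\neq0$; $\nu(x,t)\circ\nu(y,s)\ge\nu(x+y,s+t)$; $\nu(x,\cdot)$ is continuous on $(0,\infty)$; $\lim_{t\to\infty}\nu(x,t)=0$, and $\lim_{t\to0}\nu(x,t)=1$ for $x\ne0$. For $r\ge0$, $\{x_{mn}\}$ is rough $\mathcal{I}_2$-convergent to $\xi\in X$ if for every $\varepsilon>0$ and $\lambda\in(0,1)$, $\{(m,n)\in\mathbb{N}\times\mathbb{N}:\mu(x_{mn}-\xi,r+\varepsilon)\le1-\lambda\text{ or }\nu(x_{mn}-\xi,r+\varepsilon)\ge\lambda\}\in\mathcal{I}_2$. $\mathcal{I}_2^{(\mu,\nu)}\text{-}LIM_{x_{mn}}^r$ is the set of all such $\xi\in X$. *)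

theory Defs
  imports "HOL-Analysis.Analysis"
begin

locale set_ideal =
  fixes I :: "'b set set"
  assumes empty_mem: "{} \<in> I"
    and Un_mem: "A \<in> I \<Longrightarrow> B \<in> I \<Longrightarrow> A \<union> B \<in> I"
    and subset_mem: "A \<in> I \<Longrightarrow> B \<subseteq> A \<Longrightarrow> B \<in> I"

locale admissible_ideal = set_ideal I for I :: "'b set set" +
  assumes nontrivial: "UNIV \<notin> I"
    and singleton_mem: "{p} \<in> I"

text \<open>Operations on \<open>[0,1]\<close> are functions on all reals; nothing is required of their
  values at arguments outside \<open>[0,1]\<close>.\<close>

locale unit_interval_operation =
  fixes f :: "real \<Rightarrow> real \<Rightarrow> real"
  assumes closed: "x \<in> {0..1} \<Longrightarrow> y \<in> {0..1} \<Longrightarrow> f x y \<in> {0..1}"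
    and assoc: "x \<in> {0..1} \<Longrightarrow> y \<in> {0..1} \<Longrightarrow> z \<in> {0..1} \<Longrightarrow> f (f x y) z = f x (f y z)"
    and commute: "x \<in> {0..1} \<Longrightarrow> y \<in> {0..1} \<Longrightarrow> f x y = f y x"
    and continuous: "continuous_on ({0..1} \<times> {0..1}) (\<lambda>(x, y). f x y)"
    and mono_left: "x \<in> {0..1} \<Longrightarrow> y \<in> {0..1} \<Longrightarrow> z \<in> {0..1} \<Longrightarrow> x \<le> y \<Longrightarrow> f x z \<le> f y z"
    and mono_right: "x \<in> {0..1} \<Longrightarrow> y \<in> {0..1} \<Longrightarrow> z \<in> {0..1} \<Longrightarrow> x \<le> y \<Longrightarrow> f z x \<le> f z y"

locale continuous_t_norm = unit_interval_operation star for star :: "real \<Rightarrow> real \<Rightarrow> real" +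
  assumes neutral: "x \<in> {0..1} \<Longrightarrow> star x 1 = x"

locale continuous_t_conorm = unit_interval_operation circ for circ :: "real \<Rightarrow> real \<Rightarrow> real" +
  assumes neutral: "x \<in> {0..1} \<Longrightarrow> circ x 0 = x"

text \<open>The normed space \<open>X\<close> is the whole type \<open>'a\<close>, with real scalars. A complex normed space
  is covered by its underlying real space, as the scaling axioms for complex scalars include
  those for real ones. Only the values of \<open>\<mu>\<close> and \<open>\<nu>\<close> at positive second arguments matter.\<close>

locale intuitionistic_fuzzy_normed_space =
  star: continuous_t_norm star + circ: continuous_t_conorm circ
  for \<mu> \<nu> :: "'a::real_normed_vector \<Rightarrow> real \<Rightarrow> real"
    and star circ :: "real \<Rightarrow> real \<Rightarrow> real" +
  assumes mu_range: "t > 0 \<Longrightarrow> \<mu> x t \<in> {0..1}"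
    and nu_range: "t > 0 \<Longrightarrow> \<nu> x t \<in> {0..1}"
    and mu_nu_le: "t > 0 \<Longrightarrow> \<mu> x t + \<nu> x t \<le> 1"
    and mu_pos: "t > 0 \<Longrightarrow> \<mu> x t > 0"
    and mu_eq_1_iff: "t > 0 \<Longrightarrow> \<mu> x t = 1 \<longleftrightarrow> x = 0"
    and mu_scale: "t > 0 \<Longrightarrow> \<alpha> \<noteq> 0 \<Longrightarrow> \<mu> (\<alpha> *\<^sub>R x) t = \<mu> x (t / \<bar>\<alpha>\<bar>)"
    and mu_add: "s > 0 \<Longrightarrow> t > 0 \<Longrightarrow> star (\<mu> x t) (\<mu> y s) \<le> \<mu> (x + y) (t + s)"
    and mu_continuous: "continuous_on {0<..} (\<mu> x)"
    and mu_at_top: "(\<mu> x \<longlongrightarrow> 1) at_top"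
    and mu_at_0: "x \<noteq> 0 \<Longrightarrow> (\<mu> x \<longlongrightarrow> 0) (at_right 0)"
    and nu_less_1: "t > 0 \<Longrightarrow> \<nu> x t < 1"
    and nu_eq_0_iff: "t > 0 \<Longrightarrow> \<nu> x t = 0 \<longleftrightarrow> x = 0"
    and nu_scale: "t > 0 \<Longrightarrow> \<alpha> \<noteq> 0 \<Longrightarrow> \<nu> (\<alpha> *\<^sub>R x) t = \<nu> x (t / \<bar>\<alpha>\<bar>)"
    and nu_add: "s > 0 \<Longrightarrow> t > 0 \<Longrightarrow> circ (\<nu> x t) (\<nu> y s) \<ge> \<nu> (x + y) (s + t)"
    and nu_continuous: "continuous_on {0<..} (\<nu> x)"
    and nu_at_top: "(\<nu> x \<longlongrightarrow> 0) at_top"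
    and nu_at_0: "x \<noteq> 0 \<Longrightarrow> (\<nu> x \<longlongrightarrow> 1) (at_right 0)"

definition rough_ideal_convergent ::
  "(nat \<times> nat) set set \<Rightarrow> ('a::real_normed_vector \<Rightarrow> real \<Rightarrow> real) \<Rightarrow> ('a \<Rightarrow> real \<Rightarrow> real)
    \<Rightarrow> real \<Rightarrow> (nat \<Rightarrow> nat \<Rightarrow> 'a) \<Rightarrow> 'a \<Rightarrow> bool" where
  "rough_ideal_convergent I \<mu> \<nu> r x \<xi> \<longleftrightarrow>
    (\<forall>\<epsilon>>0. \<forall>lam\<in>{0<..<1}.
      {(m, n). \<mu> (x m n - \<xi>) (r + \<epsilon>) \<le> 1 - lam \<or> \<nu> (x m n - \<xi>) (r + \<epsilon>) \<ge> lam} \<in> I)"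

definition rough_ideal_LIM ::
  "(nat \<times> nat) set set \<Rightarrow> ('a::real_normed_vector \<Rightarrow> real \<Rightarrow> real) \<Rightarrow> ('a \<Rightarrow> real \<Rightarrow> real)
    \<Rightarrow> real \<Rightarrow> (nat \<Rightarrow> nat \<Rightarrow> 'a) \<Rightarrow> 'a set" where
  "rough_ideal_LIM I \<mu> \<nu> r x = {\<xi>. rough_ideal_convergent I \<mu> \<nu> r x \<xi>}"

end

theory Submission
  imports Defs
begin

text \<open>Two rough limits \<open>\<beta>\<^sub>1\<close>, \<open>\<beta>\<^sub>2\<close> have a common index \<open>(m, n)\<close> at which \<open>x m n\<close> is close to both,
  because the two exceptional sets lie in the ideal and so cannot cover everything. The triangle
  inequality through \<open>x m n\<close>, with \<open>c r\<close> split into two halves exceeding \<open>r\<close>, bounds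
  \<open>\<mu> (\<beta>\<^sub>1 - \<beta>\<^sub>2) (c r)\<close> below by \<open>(1 - s) \<star> (1 - s)\<close>, which tends to 1 as \<open>s\<close> tends to 0.\<close>

lemma (in admissible_ideal) ex_notin_Un:
  assumes "A \<in> I" and "B \<in> I"
  shows "\<exists>p. p \<notin> A \<and> p \<notin> B"
proof -
  have "A \<union> B \<noteq> UNIV"
    using Un_mem[OF assms] nontrivial by metis
  then show ?thesis by blast
qed

text \<open>Neutrality gives \<open>star 1 1 = 1\<close>, so continuity at the corner (1, 1) keeps
  the values on the diagonal above \<open>a\<close> close to that corner.\<close>

lemma (in continuous_t_norm) ex_star_self_gt:
  assumes "a < 1"
  shows "\<exists>s\<in>{0<..<1}. a < star (1 - s) (1 - s)"
proof -
  \<comment> \<open>The shift by two makes \<open>s n < 1\<close> already at \<open>n = 0\<close>;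
    the points (1 - \<open>s n\<close>, 1 - \<open>s n\<close>) stay in the unit square, the set on
    which continuity is assumed.\<close>
  define s :: "nat \<Rightarrow> real" where "s n = inverse (real (Suc (Suc n)))" for n
  have s: "s n \<in> {0<..<1}" for n
    by (auto simp: s_def field_simps)
  have "s \<longlonglongrightarrow> 0"
    unfolding s_def by (rule LIMSEQ_Suc[OF LIMSEQ_inverse_real_of_nat])
  then have "(\<lambda>n. (1 - s n, 1 - s n)) \<longlonglongrightarrow> (1 - 0, 1 - 0)"
    by (intro tendsto_intros)
  then have lim: "(\<lambda>n. (1 - s n, 1 - s n)) \<longlonglongrightarrow> (1, 1)"
    by simp
  have "\<forall>\<^sub>F n in sequentially. (1 - s n, 1 - s n) \<in> {0..1} \<times> {0..1}"
    using s by (intro always_eventually) (auto simp: less_imp_le)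
  from continuous_on_tendsto_compose[OF continuous lim _ this]
  have "(\<lambda>n. star (1 - s n) (1 - s n)) \<longlonglongrightarrow> 1"
    using neutral[of 1] by simp
  from order_tendstoD(1)[OF this assms]
  obtain n where "a < star (1 - s n) (1 - s n)"
    using eventually_happens by force
  with s show ?thesis by blast
qed

lemma (in unit_interval_operation) mono:
  assumes "0 \<le> a" "a \<le> x" "x \<le> 1" "0 \<le> b" "b \<le> y" "y \<le> 1"
  shows "f a b \<le> f x y"
proof -
  have "f a b \<le> f x b"
    using assms by (intro mono_left) auto
  also have "\<dots> \<le> f x y"
    using assms by (intro mono_right) auto
  finally show ?thesis .
qed

text \<open>Scaling by -1 leaves the second argument unchanged. This turns a bound for
  \<open>x m n - \<beta>\<^sub>1\<close> into one for \<open>\<beta>\<^sub>1 - x m n\<close>, the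
  form the triangle inequality takes.\<close>

lemma (in intuitionistic_fuzzy_normed_space) mu_minus_commute:
  "t > 0 \<Longrightarrow> \<mu> (x - y) t = \<mu> (y - x) t"
  using mu_scale[of t "-1" "x - y"] by simp

theorem theorem3p6:
  fixes I\<^sub>2 :: "(nat \<times> nat) set set"
    and \<mu> \<nu> :: "'a::real_normed_vector \<Rightarrow> real \<Rightarrow> real"
    and star circ :: "real \<Rightarrow> real \<Rightarrow> real"
    and x :: "nat \<Rightarrow> nat \<Rightarrow> 'a"
    and r lam c :: real
  assumes "admissible_ideal I\<^sub>2"
    and "intuitionistic_fuzzy_normed_space \<mu> \<nu> star circ"
    and "r > 0" and "lam \<in> {0<..<1}" and "c > 2"
  shows "\<not> (\<exists>\<beta>\<^sub>1 \<in> rough_ideal_LIM I\<^sub>2 \<mu> \<nu> r x. \<exists>\<beta>\<^sub>2 \<in> rough_ideal_LIM I\<^sub>2 \<mu> \<nu> r x.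
            \<mu> (\<beta>\<^sub>1 - \<beta>\<^sub>2) (c * r) \<le> 1 - lam \<and> \<nu> (\<beta>\<^sub>1 - \<beta>\<^sub>2) (c * r) \<ge> lam)"
proof -
  interpret admissible_ideal I\<^sub>2 by fact
  interpret intuitionistic_fuzzy_normed_space \<mu> \<nu> star circ by fact
  define t where "t = c * r / 2"
  have t: "t > r" "t > 0"
    using \<open>r > 0\<close> \<open>c > 2\<close> by (auto simp: t_def)
  obtain s where s: "s \<in> {0<..<1}" "1 - lam < star (1 - s) (1 - s)"
    using star.ex_star_self_gt[of "1 - lam"] assms(4) by auto
  \<comment> \<open>The contradiction comes from the first conjunct, the upper bound on
    \<mu>.\<close>
  have "1 - lam < \<mu> (\<beta>\<^sub>1 - \<beta>\<^sub>2) (c * r)"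
    if \<beta>: "\<beta>\<^sub>1 \<in> rough_ideal_LIM I\<^sub>2 \<mu> \<nu> r x" "\<beta>\<^sub>2 \<in> rough_ideal_LIM I\<^sub>2 \<mu> \<nu> r x" for \<beta>\<^sub>1 \<beta>\<^sub>2
  proof -
    have exceptional:
      "{(m, n). \<mu> (x m n - \<beta>) t \<le> 1 - s \<or> \<nu> (x m n - \<beta>) t \<ge> s} \<in> I\<^sub>2"
      if "\<beta> \<in> rough_ideal_LIM I\<^sub>2 \<mu> \<nu> r x" for \<beta>
      \<comment> \<open>The radius \<open>r + \<epsilon>\<close> of the definition becomes
        \<open>t\<close> for \<epsilon> = \<open>t - r\<close>, which is positive because
        \<open>c > 2\<close>.\<close>
      using that s(1) t(1)
      unfolding rough_ideal_LIM_def rough_ideal_convergent_def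
      by (auto dest!: spec[of _ "t - r"])
    obtain m n where mn: "1 - s < \<mu> (x m n - \<beta>\<^sub>1) t" "1 - s < \<mu> (x m n - \<beta>\<^sub>2) t"
      using ex_notin_Un[OF exceptional[OF \<beta>(1)] exceptional[OF \<beta>(2)]] by (auto simp: not_le)
    have "star (1 - s) (1 - s) \<le> star (\<mu> (\<beta>\<^sub>1 - x m n) t) (\<mu> (x m n - \<beta>\<^sub>2) t)"
      using mn s(1) mu_range[OF t(2)] mu_minus_commute[OF t(2), of "\<beta>\<^sub>1"]
      by (intro star.mono) (auto simp: less_imp_le)
    also have "\<dots> \<le> \<mu> (\<beta>\<^sub>1 - \<beta>\<^sub>2) (c * r)"
      using mu_add[OF t(2) t(2), of "\<beta>\<^sub>1 - x m n" "x m n - \<beta>\<^sub>2"] by (simp add: t_def)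
    finally show ?thesis
      using s(2) by linarith
  qed
  then show ?thesis
    by (meson not_le)
qed

end
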